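(* For every $n\ge1$, the number of $1$-almost-increasing permutations in $S_n$ equals the number of evil-avoiding permutations in $S_n$.
   Context: A permutation $\pi\in S_n$ (one-line form) is $1$-almost-increasing if for every $i\in\{1,\dots,n\}$ there is at most one $j\le i$ with $\pi_j>i$; equivalently, $\pi$ avoids $4321,4312,3421,3412$. A permutation is evil-avoiding if it avoids $2413,4132,4213,3214$. *)

theory Defs
  imports "HOL-Combinatorics.Combinatorics"
begin

definition perms :: "nat \<Rightarrow> (nat \<Rightarrow> nat) set" where
  "perms n = {p. p permutes {1..n}}"

definition contains_pattern :: "nat \<Rightarrow> (nat \<Rightarrow> nat) \<Rightarrow> nat list \<Rightarrow> bool" where
  "contains_pattern n p pat \<longleftrightarrow>
     (\<exists>idx :: nat \<Rightarrow> nat.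
        strict_mono_on {..<length pat} idx \<and>
        idx ` {..<length pat} \<subseteq> {1..n} \<and>
        (\<forall>a<length pat. \<forall>b<length pat. p (idx a) < p (idx b) \<longleftrightarrow> pat ! a < pat ! b))"

definition avoids :: "nat \<Rightarrow> (nat \<Rightarrow> nat) \<Rightarrow> nat list \<Rightarrow> bool" where
  "avoids n p pat \<longleftrightarrow> \<not> contains_pattern n p pat"

definition one_almost_increasing :: "nat \<Rightarrow> (nat \<Rightarrow> nat) \<Rightarrow> bool" where
  "one_almost_increasing n p \<longleftrightarrow>
     (\<forall>i\<in>{1..n}. card {j \<in> {1..i}. p j > i} \<le> 1)"

definition evil_avoiding :: "nat \<Rightarrow> (nat \<Rightarrow> nat) \<Rightarrow> bool" where
  "evil_avoiding n p \<longleftrightarrow>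
     avoids n p [2,4,1,3] \<and> avoids n p [4,1,3,2] \<and> avoids n p [4,2,1,3] \<and> avoids n p [3,2,1,4]"

end

theory Submission
  imports Defs "HOL-Library.Sublist"
begin

text \<open>Both counting sequences satisfy \<open>u\<^sub>0 = u\<^sub>1 = 1\<close> and \<open>u\<^sub>n\<^sub>+\<^sub>2 + 2 u\<^sub>n = 4 u\<^sub>n\<^sub>+\<^sub>1\<close>.

  Let \<open>B\<^sub>n\<close> be the set of 1-almost-increasing permutations. An element of \<open>B\<^sub>n\<^sub>+\<^sub>2\<close> has at most one
  of the values \<open>n+1\<close> and \<open>n+2\<close> in its first \<open>n\<close> positions, hence at least one in its last two.
  Multiplication by the transposition \<open>(n+1 n+2)\<close> on either side preserves \<open>B\<^sub>n\<^sub>+\<^sub>2\<close>; hence each of the two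
  values is there in \<open>2 u\<^sub>n\<^sub>+\<^sub>1\<close> cases and both are in \<open>2 u\<^sub>n\<close> cases.

  Write evil-avoiding permutations as words, and let \<open>a\<^sub>n\<close> be their number. A word of length \<open>n+1\<close> is a
  word \<open>P Q\<close> of length \<open>n\<close> into which a new minimum has been inserted between \<open>P\<close> and \<open>Q\<close>. Inserting it
  first or last is always allowed, so \<open>a\<^sub>n\<^sub>+\<^sub>1 = 2 a\<^sub>n + x\<^sub>n\<close>, where \<open>x\<^sub>n\<close> counts the allowed gaps with \<open>P\<close> and
  \<open>Q\<close> nonempty. Moreover \<open>x\<^sub>n\<^sub>+\<^sub>1 = x\<^sub>n + a\<^sub>n\<^sub>+\<^sub>1\<close>: if \<open>P\<close> has at least two letters and starts with its smallest
  one, delete that letter (it is one less than the smallest remaining letter of \<open>P\<close>, so it can be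
  recovered); otherwise the gap is determined by the word \<open>P Q\<close>.\<close>

section \<open>Almost increasing permutations\<close>

definition crossings :: "(nat \<Rightarrow> nat) \<Rightarrow> nat \<Rightarrow> nat set" where
  "crossings p i = {j \<in> {1..i}. p j > i}"

definition almost_increasing_perms :: "nat \<Rightarrow> (nat \<Rightarrow> nat) set" where
  "almost_increasing_perms n = {p \<in> perms n. one_almost_increasing n p}"

lemma mem_almost_increasing_perms_iff:
  "p \<in> almost_increasing_perms n \<longleftrightarrow> p permutes {1..n} \<and> one_almost_increasing n p"
  by (simp add: almost_increasing_perms_def perms_def)

lemma finite_almost_increasing_perms [simp]: "finite (almost_increasing_perms n)"
  by (simp add: almost_increasing_perms_def perms_def finite_permutations)

lemma card_crossings_le:
  assumes "p permutes {1..n}"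
  shows "card (crossings p i) \<le> n - i"
proof -
  have "p j \<le> n" if "j \<in> crossings p i" for j
    using that permutes_in_image[OF assms, of j] permutes_not_in[OF assms, of j]
    by (cases "j \<in> {1..n}") (auto simp: crossings_def)
  then have "p ` crossings p i \<subseteq> {i<..n}"
    by (auto simp: crossings_def)
  then have "card (crossings p i) \<le> card {i<..n}"
    using permutes_inj_on[OF assms] by (intro card_inj_on_le) auto
  then show ?thesis by simp
qed

lemma one_almost_increasing_iff:
  assumes "p permutes {1..n}"
  shows "one_almost_increasing n p \<longleftrightarrow> (\<forall>i. card (crossings p i) \<le> 1)"
proof -
  have "card (crossings p i) \<le> 1" if "i \<notin> {1..n}" for i
  proof (cases "i = 0")
    case False
    then show ?thesis using that card_crossings_le[OF assms, of i] by simp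
  qed (simp add: crossings_def)
  then show ?thesis
    unfolding one_almost_increasing_def crossings_def by blast
qed

lemma one_almost_increasing_cong:
  assumes p: "p permutes {1..n}" and q: "q permutes {1..n}"
    and eq: "\<And>i. Suc i < n \<Longrightarrow> crossings p i = crossings q i"
  shows "one_almost_increasing n p \<longleftrightarrow> one_almost_increasing n q"
proof -
  have "card (crossings p i) \<le> 1 \<longleftrightarrow> card (crossings q i) \<le> 1" for i
    using eq[of i] card_crossings_le[OF p, of i] card_crossings_le[OF q, of i]
    by (cases "Suc i < n") auto
  then show ?thesis
    using p q by (simp add: one_almost_increasing_iff)
qed

lemma permutes_atLeastAtMost_Suc_iff:
  "p permutes {1..n} \<longleftrightarrow> p permutes {1..Suc n} \<and> p (Suc n) = Suc n"
proof
  assume "p permutes {1..Suc n} \<and> p (Suc n) = Suc n"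
  then show "p permutes {1..n}"
    by (elim conjE permutes_superset) (auto simp: le_Suc_eq)
next
  assume "p permutes {1..n}"
  then show "p permutes {1..Suc n} \<and> p (Suc n) = Suc n"
    by (auto intro: permutes_subset simp: permutes_not_in)
qed

lemma almost_increasing_perms_eq_fixing_top:
  "almost_increasing_perms n = {p \<in> almost_increasing_perms (Suc n). p (Suc n) = Suc n}"
proof -
  have "p permutes {1..n} \<and> one_almost_increasing n p \<longleftrightarrow>
      (p permutes {1..Suc n} \<and> one_almost_increasing (Suc n) p) \<and> p (Suc n) = Suc n" for p
    using permutes_atLeastAtMost_Suc_iff[of p n] one_almost_increasing_iff by blast
  then show ?thesis
    by (simp add: set_eq_iff mem_almost_increasing_perms_iff)
qed

lemma card_almost_increasing_perms_base:
  "card (almost_increasing_perms 0) = 1" "card (almost_increasing_perms (Suc 0)) = 1"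
proof -
  have "crossings id i = {}" for i
    by (auto simp: crossings_def)
  then have "one_almost_increasing n id" for n
    using one_almost_increasing_iff[OF permutes_id, of n] by simp
  then have "almost_increasing_perms 0 = {id}" "almost_increasing_perms (Suc 0) = {id}"
    by (auto simp: almost_increasing_perms_def perms_def)
  then show "card (almost_increasing_perms 0) = 1" "card (almost_increasing_perms (Suc 0)) = 1"
    by simp_all
qed

lemma crossings_comp_transpose:
  assumes "i < a" "i < b"
  shows "crossings (p \<circ> transpose a b) i = crossings p i"
  using assms by (auto simp: crossings_def transpose_def)

lemma crossings_transpose_comp:
  assumes "i < a" "i < b"
  shows "crossings (transpose a b \<circ> p) i = crossings p i"
  using assms by (auto simp: crossings_def transpose_def split: if_splits)

abbreviation swap_top :: "nat \<Rightarrow> nat \<Rightarrow> nat" where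
  "swap_top m \<equiv> transpose (Suc m) (Suc (Suc m))"

lemma swap_top_in_almost_increasing_perms:
  assumes "p \<in> almost_increasing_perms (Suc (Suc m))"
  shows "p \<circ> swap_top m \<in> almost_increasing_perms (Suc (Suc m))"
    and "swap_top m \<circ> p \<in> almost_increasing_perms (Suc (Suc m))"
proof -
  have p: "p permutes {1..Suc (Suc m)}" "one_almost_increasing (Suc (Suc m)) p"
    using assms by (simp_all add: mem_almost_increasing_perms_iff)
  have "swap_top m permutes {1..Suc (Suc m)}"
    by (rule permutes_swap_id) auto
  then have perms: "p \<circ> swap_top m permutes {1..Suc (Suc m)}" "swap_top m \<circ> p permutes {1..Suc (Suc m)}"
    using p(1) by (auto intro: permutes_compose)
  have "one_almost_increasing (Suc (Suc m)) (p \<circ> swap_top m)"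
    using one_almost_increasing_cong[OF perms(1) p(1)] p(2) by (simp add: crossings_comp_transpose)
  moreover have "one_almost_increasing (Suc (Suc m)) (swap_top m \<circ> p)"
    using one_almost_increasing_cong[OF perms(2) p(1)] p(2) by (simp add: crossings_transpose_comp)
  ultimately show "p \<circ> swap_top m \<in> almost_increasing_perms (Suc (Suc m))"
    and "swap_top m \<circ> p \<in> almost_increasing_perms (Suc (Suc m))"
    using perms by (simp_all add: mem_almost_increasing_perms_iff)
qed

lemma almost_increasing_perms_top_cases:
  assumes "p \<in> almost_increasing_perms (Suc (Suc m))"
  shows "Suc m \<in> p ` {Suc m, Suc (Suc m)} \<or> Suc (Suc m) \<in> p ` {Suc m, Suc (Suc m)}"
proof (rule ccontr)
  assume not_top: "\<not> ?thesis"
  have p: "p permutes {1..Suc (Suc m)}" and few_crossings: "card (crossings p m) \<le> 1"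
    using assms one_almost_increasing_iff by (auto simp: mem_almost_increasing_perms_iff)
  obtain k l where kl: "p k = Suc m" "p l = Suc (Suc m)"
    using permutes_surj[OF p] by (metis surjD)
  then have "k \<in> {1..Suc (Suc m)}" "l \<in> {1..Suc (Suc m)}"
    using permutes_in_image[OF p, of k] permutes_in_image[OF p, of l] by auto
  moreover have "k \<notin> {Suc m, Suc (Suc m)}" "l \<notin> {Suc m, Suc (Suc m)}"
    using not_top kl by (metis imageI)+
  ultimately have "{k, l} \<subseteq> crossings p m"
    using kl by (auto simp: crossings_def)
  then have "card {k, l} \<le> card (crossings p m)"
    by (intro card_mono) (simp add: crossings_def)
  moreover have "k \<noteq> l" using kl by auto
  ultimately show False
    using few_crossings by simp
qed

lemma card_eq_double_by_involution:
  assumes "finite T" and "\<And>x. x \<in> T \<Longrightarrow> f x \<in> T \<and> f (f x) = x \<and> (P (f x) \<longleftrightarrow> \<not> P x)"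
  shows "card T = 2 * card {x \<in> T. P x}"
proof -
  have "bij_betw f {x \<in> T. P x} {x \<in> T. \<not> P x}"
    by (rule bij_betw_byWitness[where f' = f]) (use assms(2) in auto)
  then have "card {x \<in> T. \<not> P x} = card {x \<in> T. P x}"
    by (simp add: bij_betw_same_card)
  moreover have "card T = card {x \<in> T. P x} + card {x \<in> T. \<not> P x}"
    using card_Int_Diff[OF assms(1), of "Collect P"] by (simp add: Int_def set_diff_eq)
  ultimately show ?thesis by simp
qed

lemma almost_increasing_perms_top_le:
  assumes "p \<in> almost_increasing_perms (Suc (Suc m))"
  shows "p (Suc (Suc m)) \<le> Suc (Suc m)" "p (Suc m) \<le> Suc (Suc m)"
  using assms permutes_in_image[of p "{1..Suc (Suc m)}" "Suc m"]
    permutes_in_image[of p "{1..Suc (Suc m)}" "Suc (Suc m)"]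
  by (auto simp: mem_almost_increasing_perms_iff)

lemma almost_increasing_perms_top_neq:
  assumes "p \<in> almost_increasing_perms (Suc (Suc m))"
  shows "p (Suc m) \<noteq> p (Suc (Suc m))"
  using assms permutes_inj[of p] by (auto simp: mem_almost_increasing_perms_iff inj_eq)

lemma card_closed_under_swap_top:
  assumes sub: "T \<subseteq> almost_increasing_perms (Suc (Suc m))"
    and closed: "\<And>p. p \<in> T \<Longrightarrow> p \<circ> swap_top m \<in> T"
  shows "card T = 2 * card {p \<in> T. p (Suc m) < p (Suc (Suc m))}"
proof (rule card_eq_double_by_involution[where f = "\<lambda>p. p \<circ> swap_top m"])
  show "finite T" using sub by (rule finite_subset) simp
  fix p assume p: "p \<in> T"
  then have "p (Suc m) \<noteq> p (Suc (Suc m))"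
    using sub almost_increasing_perms_top_neq by blast
  then show "p \<circ> swap_top m \<in> T \<and> p \<circ> swap_top m \<circ> swap_top m = p \<and>
      ((p \<circ> swap_top m) (Suc m) < (p \<circ> swap_top m) (Suc (Suc m)) \<longleftrightarrow> \<not> p (Suc m) < p (Suc (Suc m)))"
    using closed[OF p] by (auto simp: comp_assoc)
qed

definition almost_increasing_with_top :: "nat \<Rightarrow> nat \<Rightarrow> (nat \<Rightarrow> nat) set" where
  "almost_increasing_with_top m v =
     {p \<in> almost_increasing_perms (Suc (Suc m)). v \<in> p ` {Suc m, Suc (Suc m)}}"

lemma almost_increasing_with_top_subset:
  "almost_increasing_with_top m v \<subseteq> almost_increasing_perms (Suc (Suc m))"
  by (auto simp: almost_increasing_with_top_def)

lemma almost_increasing_with_top_comp_swap_top: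
  assumes "p \<in> almost_increasing_with_top m v"
  shows "p \<circ> swap_top m \<in> almost_increasing_with_top m v"
  using assms swap_top_in_almost_increasing_perms(1)
  by (auto simp: almost_increasing_with_top_def)

lemma card_almost_increasing_with_top_max:
  "card (almost_increasing_with_top m (Suc (Suc m))) = 2 * card (almost_increasing_perms (Suc m))"
proof -
  have "Suc (Suc m) \<in> p ` {Suc m, Suc (Suc m)} \<and> p (Suc m) < p (Suc (Suc m)) \<longleftrightarrow>
      p (Suc (Suc m)) = Suc (Suc m)"
    if "p \<in> almost_increasing_perms (Suc (Suc m))" for p
    using almost_increasing_perms_top_le[OF that] almost_increasing_perms_top_neq[OF that] by auto
  then have "{p \<in> almost_increasing_with_top m (Suc (Suc m)). p (Suc m) < p (Suc (Suc m))}
      = almost_increasing_perms (Suc m)"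
    unfolding almost_increasing_perms_eq_fixing_top[of "Suc m"] almost_increasing_with_top_def by blast
  moreover have "card (almost_increasing_with_top m (Suc (Suc m)))
      = 2 * card {p \<in> almost_increasing_with_top m (Suc (Suc m)). p (Suc m) < p (Suc (Suc m))}"
    by (intro card_closed_under_swap_top almost_increasing_with_top_subset
        almost_increasing_with_top_comp_swap_top)
  ultimately show ?thesis by simp
qed

lemma card_almost_increasing_with_top_second:
  "card (almost_increasing_with_top m (Suc m)) = card (almost_increasing_with_top m (Suc (Suc m)))"
proof -
  have swap: "swap_top m \<circ> p \<in> almost_increasing_with_top m (swap_top m v)"
    if "p \<in> almost_increasing_with_top m v" for p v
    using that swap_top_in_almost_increasing_perms(2)
    by (auto simp: almost_increasing_with_top_def)
  have "bij_betw ((\<circ>) (swap_top m)) (almost_increasing_with_top m (Suc m))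
      (almost_increasing_with_top m (Suc (Suc m)))"
    by (rule bij_betw_byWitness[where f' = "(\<circ>) (swap_top m)"])
      (use swap[of _ "Suc m"] swap[of _ "Suc (Suc m)"] in \<open>auto simp: fun_eq_iff\<close>)
  then show ?thesis by (rule bij_betw_same_card)
qed

lemma card_almost_increasing_with_top_both:
  "card (almost_increasing_with_top m (Suc m) \<inter> almost_increasing_with_top m (Suc (Suc m)))
     = 2 * card (almost_increasing_perms m)"
  (is "card ?T = _")
proof -
  have "{p \<in> ?T. p (Suc m) < p (Suc (Suc m))}
      = {p \<in> almost_increasing_perms (Suc (Suc m)). p (Suc m) = Suc m \<and> p (Suc (Suc m)) = Suc (Suc m)}"
    by (auto simp: almost_increasing_with_top_def)
  also have "\<dots> = almost_increasing_perms m"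
    unfolding almost_increasing_perms_eq_fixing_top[of m] almost_increasing_perms_eq_fixing_top[of "Suc m"]
    by blast
  finally have "{p \<in> ?T. p (Suc m) < p (Suc (Suc m))} = almost_increasing_perms m" .
  moreover have "card ?T = 2 * card {p \<in> ?T. p (Suc m) < p (Suc (Suc m))}"
  proof (rule card_closed_under_swap_top)
    show "?T \<subseteq> almost_increasing_perms (Suc (Suc m))"
      using almost_increasing_with_top_subset by blast
    show "p \<circ> swap_top m \<in> ?T" if "p \<in> ?T" for p
      using that almost_increasing_with_top_comp_swap_top by blast
  qed
  ultimately show ?thesis by simp
qed

lemma card_almost_increasing_perms_rec:
  "card (almost_increasing_perms (Suc (Suc m))) + 2 * card (almost_increasing_perms m)
     = 4 * card (almost_increasing_perms (Suc m))"
proof -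
  let ?X = "almost_increasing_with_top m (Suc m)" and ?Y = "almost_increasing_with_top m (Suc (Suc m))"
  have "almost_increasing_perms (Suc (Suc m)) = ?X \<union> ?Y"
    using almost_increasing_perms_top_cases unfolding almost_increasing_with_top_def by blast
  moreover have "card ?X + card ?Y = card (?X \<union> ?Y) + card (?X \<inter> ?Y)"
    by (rule card_Un_Int) (simp_all add: almost_increasing_with_top_def)
  ultimately show ?thesis
    by (simp add: card_almost_increasing_with_top_max card_almost_increasing_with_top_second
        card_almost_increasing_with_top_both)
qed

section \<open>Subsequences\<close>

lemma subseq_Cons_Cons_iff:
  "subseq (x # xs) (y # ys) \<longleftrightarrow> x = y \<and> subseq xs ys \<or> subseq (x # xs) ys"
  by (auto dest: subseq_Cons')

lemma subseq_imp_set_subset: "subseq xs ys \<Longrightarrow> set xs \<subseteq> set ys"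
  by (auto dest: list_emb_set)

lemma subseq_imp_distinct: "subseq xs ys \<Longrightarrow> distinct ys \<Longrightarrow> distinct xs"
  by (auto simp: subseq_conv_nths)

lemma sorted_wrt_iff_subseq: "sorted_wrt R xs \<longleftrightarrow> (\<forall>x y. subseq [x, y] xs \<longrightarrow> R x y)"
proof (induction xs)
  case (Cons a xs)
  then show ?case
    unfolding subseq_Cons_Cons_iff subseq_singleton_left by auto
qed simp

lemma sorted_wrt_subseq: "subseq xs ys \<Longrightarrow> sorted_wrt R ys \<Longrightarrow> sorted_wrt R xs"
  unfolding sorted_wrt_iff_subseq by (meson subseq_order.trans)

lemma subseq_map_iff: "subseq ys (map f xs) \<longleftrightarrow> (\<exists>zs. subseq zs xs \<and> ys = map f zs)"
  by (auto simp: subseq_conv_nths nths_map)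

lemma subseq_insert_iff:
  "subseq us (P @ z # Q) \<longleftrightarrow>
     subseq us (P @ Q) \<or> (\<exists>us1 us2. us = us1 @ z # us2 \<and> subseq us1 P \<and> subseq us2 Q)"
proof
  assume "subseq us (P @ z # Q)"
  then obtain us1 vs where us: "us = us1 @ vs" "subseq us1 P" "subseq vs (z # Q)"
    by (rule subseq_appendE)
  then consider "subseq vs Q" | us2 where "vs = z # us2" "subseq us2 Q"
    by (cases vs) (auto split: if_splits)
  then show "subseq us (P @ Q) \<or> (\<exists>us1 us2. us = us1 @ z # us2 \<and> subseq us1 P \<and> subseq us2 Q)"
    using us(1,2) by cases (auto intro: list_emb_append_mono)
next
  assume "subseq us (P @ Q) \<or> (\<exists>us1 us2. us = us1 @ z # us2 \<and> subseq us1 P \<and> subseq us2 Q)"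
  then show "subseq us (P @ z # Q)"
    unfolding subseq_append_iff by (auto intro: subseq_Cons2)
qed

section \<open>Words avoiding the evil patterns\<close>

definition evil :: "'a::linorder \<Rightarrow> 'a \<Rightarrow> 'a \<Rightarrow> 'a \<Rightarrow> bool" where
  "evil a b c d \<longleftrightarrow>
     c < a \<and> a < d \<and> d < b \<or> b < d \<and> d < c \<and> c < a \<or>
     c < b \<and> b < d \<and> d < a \<or> c < b \<and> b < a \<and> a < d"

definition evil_free :: "'a::linorder list \<Rightarrow> bool" where
  "evil_free xs \<longleftrightarrow> (\<forall>a b c d. subseq [a, b, c, d] xs \<longrightarrow> \<not> evil a b c d)"

lemma evil_freeD: "evil_free xs \<Longrightarrow> subseq [a, b, c, d] xs \<Longrightarrow> \<not> evil a b c d"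
  unfolding evil_free_def by blast

lemma evil_free_subseq: "evil_free ys \<Longrightarrow> subseq xs ys \<Longrightarrow> evil_free xs"
  unfolding evil_free_def by (meson subseq_order.trans)

lemma evil_free_if_length_less: "length xs < 4 \<Longrightarrow> evil_free xs"
  by (simp add: evil_free_def not_subseq_length)

lemma evil_free_Cons_iff:
  "evil_free (x # xs) \<longleftrightarrow> evil_free xs \<and> (\<forall>b c d. subseq [b, c, d] xs \<longrightarrow> \<not> evil x b c d)"
  unfolding evil_free_def subseq_Cons_Cons_iff by blast

lemma evil_free_map_iff:
  assumes "strict_mono f"
  shows "evil_free (map f xs) \<longleftrightarrow> evil_free xs"
proof -
  have evil_map: "evil (f a) (f b) (f c) (f d) \<longleftrightarrow> evil a b c d" for a b c d
    by (simp add: evil_def strict_mono_less[OF assms])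
  show ?thesis
  proof
    assume "evil_free (map f xs)"
    then show "evil_free xs"
      using evil_map subseq_map[of _ xs f] unfolding evil_free_def by fastforce
  next
    assume "evil_free xs"
    then show "evil_free (map f xs)"
      using evil_map unfolding evil_free_def subseq_map_iff by (auto simp: map_eq_Cons_conv)
  qed
qed

text \<open>A new minimum between \<open>P\<close> and \<open>Q\<close> can only become the letter 1 of an evil pattern, that is, the
  third letter of 2413, 4213 and 3214 or the second letter of 4132. For words with distinct letters,
  the first conjunct excludes the former and the second one the latter.\<close>

definition open_gap :: "'a::linorder list \<Rightarrow> 'a list \<Rightarrow> bool" where
  "open_gap P Q \<longleftrightarrow>
     (\<forall>w\<in>set Q. sorted_wrt (\<lambda>x y. w < x \<and> w < y \<or> x < y \<and> y < w) P) \<and>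
     (\<forall>x\<in>set P. sorted_wrt (\<lambda>y w. y < x \<longrightarrow> y < w) Q)"

lemma open_gap_Nil [simp]: "open_gap [] Q" "open_gap P []"
  by (simp_all add: open_gap_def)

lemma open_gap_singleton: "open_gap [a] Q \<longleftrightarrow> sorted_wrt (\<lambda>y w. y < a \<longrightarrow> y < w) Q"
  by (simp add: open_gap_def)

lemma open_gap_map_iff:
  assumes "strict_mono f"
  shows "open_gap (map f P) (map f Q) \<longleftrightarrow> open_gap P Q"
  by (simp add: open_gap_def sorted_wrt_map strict_mono_less[OF assms])

lemma open_gap_same_side:
  assumes "open_gap P Q" "x \<in> set P" "y \<in> set P" "x \<noteq> y" "w \<in> set Q"
  shows "w < x \<and> w < y \<or> x < w \<and> y < w"
proof -
  have "subseq [x, y] P \<or> subseq [y, x] P"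
    using assms(2-4) by (induction P) (auto simp: subseq_singleton_left)
  moreover have "w < u \<and> w < v \<or> u < v \<and> v < w" if "subseq [u, v] P" for u v
    using that assms(1,5) unfolding open_gap_def sorted_wrt_iff_subseq by blast
  ultimately show ?thesis by fastforce
qed

lemma open_gap_Cons_descent_iff:
  assumes "y \<in> set P" "y < a"
  shows "open_gap (a # P) Q \<longleftrightarrow> (\<forall>x\<in>set (a # P). \<forall>w\<in>set Q. w < x) \<and> sorted_wrt (<) Q"
proof
  assume gap: "open_gap (a # P) Q"
  have below_a: "w < a" if "w \<in> set Q" for w
    using gap assms that by (force simp: open_gap_def)
  have "w < x" if "x \<in> set (a # P)" "w \<in> set Q" for x w
    using open_gap_same_side[OF gap that(1), of a w] below_a[OF that(2)] that by fastforce
  moreover have "sorted_wrt (<) Q"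
  proof (rule sorted_wrt_mono_rel)
    show "sorted_wrt (\<lambda>u w. u < a \<longrightarrow> u < w) Q"
      using gap by (simp add: open_gap_def)
  qed (use below_a in blast)
  ultimately show "(\<forall>x\<in>set (a # P). \<forall>w\<in>set Q. w < x) \<and> sorted_wrt (<) Q" by blast
next
  assume below: "(\<forall>x\<in>set (a # P). \<forall>w\<in>set Q. w < x) \<and> sorted_wrt (<) Q"
  have "sorted_wrt (\<lambda>x y. w < x \<and> w < y \<or> x < y \<and> y < w) (a # P)" if "w \<in> set Q" for w
    by (rule sorted_wrt_mono_rel[where P = "\<lambda>_ _. True"]) (use below that in auto)
  moreover have "sorted_wrt (\<lambda>y w. y < x \<longrightarrow> y < w) Q" for x
    using below by (auto elim: sorted_wrt_mono_rel[rotated])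
  ultimately show "open_gap (a # P) Q" unfolding open_gap_def by blast
qed

lemma evil_free_insert_min_iff_evil:
  assumes min: "\<forall>x\<in>set (P @ Q). z < x"
  shows "evil_free (P @ z # Q) \<longleftrightarrow> evil_free (P @ Q) \<and>
    (\<forall>x y w. subseq [x, y] P \<longrightarrow> w \<in> set Q \<longrightarrow> \<not> evil x y z w) \<and>
    (\<forall>x y w. x \<in> set P \<longrightarrow> subseq [y, w] Q \<longrightarrow> \<not> evil x z y w)"
    (is "_ \<longleftrightarrow> _ \<and> ?third \<and> ?second")
proof (intro iffI conjI allI impI)
  assume ef: "evil_free (P @ z # Q)"
  show "evil_free (P @ Q)"
    using ef by (rule evil_free_subseq) (auto simp: subseq_insert_iff)
  have sub: "subseq (us @ z # vs) (P @ z # Q)" if "subseq us P" "subseq vs Q" for us vs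
    using that by (intro list_emb_append_mono subseq_Cons2)
  show "\<not> evil x y z w" if "subseq [x, y] P" "w \<in> set Q" for x y w
    using that sub[of "[x, y]" "[w]"] evil_freeD[OF ef] by (simp add: subseq_singleton_left)
  show "\<not> evil x z y w" if "x \<in> set P" "subseq [y, w] Q" for x y w
    using that sub[of "[x]" "[y, w]"] evil_freeD[OF ef] by (simp add: subseq_singleton_left)
next
  assume rhs: "evil_free (P @ Q) \<and> ?third \<and> ?second"
  have "\<not> evil a b c d" if us: "[a, b, c, d] = us1 @ z # us2" "subseq us1 P" "subseq us2 Q"
    for a b c d us1 us2
  proof -
    have less: "z < x" if "x \<in> set us1 \<union> set us2" for x
      using that min us(2,3) by (auto dest: subseq_imp_set_subset)
    consider "a = z" "us2 = [b, c, d]" | "us1 = [a]" "b = z" "us2 = [c, d]"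
      | "us1 = [a, b]" "c = z" "us2 = [d]" | "us1 = [a, b, c]" "d = z"
      using us(1) by (auto simp: Cons_eq_append_conv)
    then show ?thesis
    proof cases
      case 2
      then show ?thesis using rhs us by (simp add: subseq_singleton_left)
    next
      case 3
      then show ?thesis using rhs us by (simp add: subseq_singleton_left)
    qed (use less in \<open>auto simp: evil_def not_less less_imp_le\<close>)
  qed
  then show "evil_free (P @ z # Q)"
    using rhs unfolding evil_free_def subseq_insert_iff by blast
qed

lemma evil_free_insert_min_iff:
  assumes min: "\<forall>x\<in>set (P @ Q). z < x" and dist: "distinct (P @ Q)"
  shows "evil_free (P @ z # Q) \<longleftrightarrow> evil_free (P @ Q) \<and> open_gap P Q"
proof -
  have neq: "u \<noteq> v" if "subseq [u, v] P \<or> subseq [u, v] Q" for u v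
    using that dist subseq_imp_distinct[of "[u, v]"] by auto
  have "\<not> evil x y z w \<longleftrightarrow> w < x \<and> w < y \<or> x < y \<and> y < w"
    if "subseq [x, y] P" "w \<in> set Q" for x y w
  proof -
    have "x \<in> set P" "y \<in> set P" using subseq_imp_set_subset[OF that(1)] by simp_all
    then have "z < x" "z < y" "z < w" "x \<noteq> w" "y \<noteq> w" using min dist that(2) by auto
    then show ?thesis using neq[of x y] that(1) by (auto simp: evil_def)
  qed
  moreover have "\<not> evil x z y w \<longleftrightarrow> (y < x \<longrightarrow> y < w)" if "x \<in> set P" "subseq [y, w] Q" for x y w
  proof -
    have "y \<in> set Q" "w \<in> set Q" using subseq_imp_set_subset[OF that(2)] by simp_all
    then have "z < x" "z < y" "z < w" using min that(1) by auto
    then show ?thesis using neq[of y w] that(2) by (auto simp: evil_def)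
  qed
  ultimately show ?thesis
    unfolding evil_free_insert_min_iff_evil[OF min] open_gap_def sorted_wrt_iff_subseq by blast
qed

lemma evil_increase_first:
  assumes "evil a x y w" "a < b" "\<And>v. v \<in> {x, y, w} \<Longrightarrow> v < a \<or> b < v"
  shows "evil b x y w"
  using assms unfolding evil_def by (metis insertCI less_trans order_less_asym)

lemma evil_free_Cons_below:
  assumes ef: "evil_free (P @ Q)" and gap: "open_gap P Q"
    and b: "b \<in> set P" "\<And>x. x \<in> set P \<Longrightarrow> b \<le> x"
    and a: "a < b" "\<And>x. x \<in> set Q \<Longrightarrow> x < a \<or> b < x"
  shows "evil_free (a # P @ Q)"
proof -
  have "\<not> evil a x y w" if sub: "subseq [x, y, w] (P @ Q)" for x y w
  proof
    assume evil: "evil a x y w"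
    from sub obtain us vs where uv: "[x, y, w] = us @ vs" "subseq us P" "subseq vs Q"
      by (rule subseq_appendE)
    then consider "vs = [x, y, w]" | "us = [x]" "vs = [y, w]" | us' where "us = x # y # us'"
      by (auto simp: Cons_eq_append_conv)
    then show False
    proof cases
      case 1
      then have sub_Q: "subseq [x, y, w] Q" using uv(3) by simp
      then have "subseq ([b] @ [x, y, w]) (P @ Q)"
        using b(1) by (intro list_emb_append_mono) (simp_all add: subseq_singleton_left)
      then have "\<not> evil b x y w" using evil_freeD[OF ef] by simp
      moreover have "v < a \<or> b < v" if "v \<in> {x, y, w}" for v
        using a(2) subseq_imp_set_subset[OF sub_Q] that by auto
      ultimately show False using evil_increase_first[OF evil a(1)] by blast
    next
      case 2
      then have x: "x \<in> set P" and w: "w \<in> set Q"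
        using uv subseq_imp_set_subset[of vs Q] by (simp_all add: subseq_singleton_left)
      have "a < x" using a(1) b(2)[OF x] by simp
      then have "a < w" "w < x" using evil by (auto simp: evil_def)
      moreover from this have "b < w" using a(2)[OF w] by auto
      ultimately show False using open_gap_same_side[OF gap x b(1) _ w] by fastforce
    next
      case 3
      then have "x \<in> set P" "y \<in> set P" using subseq_imp_set_subset[OF uv(2)] by simp_all
      then have "a < x" "a < y" using a(1) b(2) by fastforce+
      then show False using evil by (auto simp: evil_def)
    qed
  qed
  then show ?thesis using ef by (simp add: evil_free_Cons_iff)
qed

lemma open_gap_Cons_below:
  assumes gap: "open_gap P Q"
    and b: "b \<in> set P" "\<And>x. x \<in> set P \<Longrightarrow> b \<le> x"
    and a: "a < b" "\<And>x. x \<in> set Q \<Longrightarrow> x < a \<or> b < x"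
  shows "open_gap (a # P) Q"
proof -
  have "w < a \<and> w < x \<or> a < x \<and> x < w" if x: "x \<in> set P" and w: "w \<in> set Q" for x w
    using a(2)[OF w]
  proof
    assume "w < a"
    then show ?thesis using a(1) b(2)[OF x] by auto
  next
    assume "b < w"
    then show ?thesis using a(1) b(2)[OF x] open_gap_same_side[OF gap x b(1) _ w] by fastforce
  qed
  moreover have "sorted_wrt (\<lambda>y w. y < a \<longrightarrow> y < w) Q"
  proof (rule sorted_wrt_mono_rel)
    show "sorted_wrt (\<lambda>y w. y < b \<longrightarrow> y < w) Q"
      using gap b(1) by (simp add: open_gap_def)
  qed (use a(1) in auto)
  ultimately show ?thesis using gap by (simp add: open_gap_def)
qed

definition rising_gap :: "'a::linorder list \<Rightarrow> 'a list \<Rightarrow> bool" where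
  "rising_gap P Q \<longleftrightarrow> open_gap P Q \<and> tl P \<noteq> [] \<and> Q \<noteq> [] \<and> (\<forall>x\<in>set (tl P). hd P < x)"

definition falling_gap :: "'a::linorder list \<Rightarrow> 'a list \<Rightarrow> bool" where
  "falling_gap P Q \<longleftrightarrow>
     open_gap P Q \<and> P \<noteq> [] \<and> Q \<noteq> [] \<and> (tl P = [] \<or> (\<exists>y\<in>set (tl P). y < hd P))"

lemma falling_gap_iff_not_rising_gap:
  assumes "open_gap P Q" "P \<noteq> []" "Q \<noteq> []" "distinct P"
  shows "falling_gap P Q \<longleftrightarrow> \<not> rising_gap P Q"
proof -
  have "hd P \<notin> set (tl P)" using assms(2,4) by (cases P) auto
  then show ?thesis
    using assms(1-3) unfolding rising_gap_def falling_gap_def by (metis linorder_less_linear order_less_asym)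
qed

text \<open>The gap is right before the smallest letter of the tail if a letter below the first one precedes
  that letter, and right after the first letter otherwise.\<close>

lemma ex_falling_gap:
  assumes ef: "evil_free xs" and dist: "distinct xs" and len: "length xs \<ge> 2"
  obtains P Q where "xs = P @ Q" "falling_gap P Q"
proof -
  obtain a t where xs: "xs = a # t" and t: "t \<noteq> []"
    using len by (cases xs) force+
  define m where "m = Min (set t)"
  have m: "m \<in> set t" "\<And>x. x \<in> set t \<Longrightarrow> m \<le> x"
    using t by (simp_all add: m_def)
  then obtain R T where RT: "t = R @ m # T" by (meson split_list)
  have m_less: "m < x" if "x \<in> set R \<union> set T" for x
    using that m(2)[of x] dist by (auto simp: xs RT order_le_less)
  have min_below_a: "open_gap (a # R) T" if "m < a"
    using evil_free_insert_min_iff[of "a # R" T m] ef dist m_less that by (simp add: xs RT)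
  show ?thesis
  proof (cases "\<exists>y\<in>set R. y < a")
    case True
    then obtain y where y: "y \<in> set R" "y < a" by blast
    then have "m < a" using m_less[of y] by simp
    then have "open_gap (a # R) (m # T)"
      using min_below_a y m_less by (simp add: open_gap_Cons_descent_iff[OF y])
    then have "falling_gap (a # R) (m # T)"
      using y by (auto simp: falling_gap_def)
    then show ?thesis
      using that[of "a # R" "m # T"] by (simp add: xs RT)
  next
    case False
    have "sorted_wrt (\<lambda>y w. y < a \<longrightarrow> y < w) T" if "m < a"
      using min_below_a[OF that] by (simp add: open_gap_def)
    moreover have "sorted_wrt (\<lambda>y w. y < a \<longrightarrow> y < w) T" if "\<not> m < a"
      by (rule sorted_wrt_mono_rel[where P = "\<lambda>_ _. True"]) (use that m_less in fastforce)+
    ultimately have "open_gap [a] t"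
      unfolding open_gap_singleton RT sorted_wrt_append using False m_less
      by (auto intro: sorted_wrt_mono_rel[where P = "\<lambda>_ _. True"])
    then show ?thesis
      using that[of "[a]" t] t by (simp add: xs falling_gap_def)
  qed
qed

lemma falling_gap_not_movable:
  assumes gap: "falling_gap P (U @ Q)" and gap': "falling_gap (P @ U) Q"
  shows "U = []"
proof (rule ccontr)
  assume "U \<noteq> []"
  obtain a R where P: "P = a # R" using gap by (cases P) (auto simp: falling_gap_def)
  have "Q \<noteq> []" using gap' by (simp add: falling_gap_def)
  then obtain w where w: "w \<in> set Q" by (meson last_in_set)
  obtain y where y: "y \<in> set (R @ U)" "y < a"
    using gap' \<open>U \<noteq> []\<close> by (auto simp: P falling_gap_def)
  then have below: "w < x" if "x \<in> set (P @ U)" for x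
    using gap' that w open_gap_Cons_descent_iff[OF y, of Q] by (auto simp: P falling_gap_def)
  obtain u where u: "u \<in> set U" "u < a"
  proof (cases "R = []")
    case False
    then obtain y' where "y' \<in> set R" "y' < a"
      using gap by (auto simp: P falling_gap_def)
    then have "hd U < a"
      using gap open_gap_Cons_descent_iff[of y' R a "U @ Q"] \<open>U \<noteq> []\<close> by (auto simp: P falling_gap_def)
    then show ?thesis using that \<open>U \<noteq> []\<close> by (meson hd_in_set)
  qed (use y that in auto)
  have "sorted_wrt (\<lambda>y w. y < a \<longrightarrow> y < w) (U @ Q)"
    using gap by (simp add: open_gap_def falling_gap_def P)
  then have "u < w" using u w by (auto simp: sorted_wrt_append)
  then show False using below[of u] u(1) by simp
qed

lemma falling_gap_unique:
  assumes "P @ Q = P' @ Q'" "falling_gap P Q" "falling_gap P' Q'"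
  shows "P = P'"
proof -
  obtain U where "P = P' @ U \<and> U @ Q = Q' \<or> P @ U = P' \<and> Q = U @ Q'"
    using assms(1) by (auto simp: append_eq_append_conv2)
  then show ?thesis
    using falling_gap_not_movable[of P' U Q] falling_gap_not_movable[of P U Q'] assms(2,3) by auto
qed

section \<open>Counting evil-free words\<close>

definition evil_free_words :: "'a::linorder set \<Rightarrow> 'a list set" where
  "evil_free_words S = {xs \<in> permutations_of_set S. evil_free xs}"

definition open_gaps :: "'a::linorder set \<Rightarrow> ('a list \<times> 'a list) set" where
  "open_gaps S = {(P, Q). P @ Q \<in> evil_free_words S \<and> open_gap P Q}"

definition interior_gaps :: "'a::linorder set \<Rightarrow> ('a list \<times> 'a list) set" where
  "interior_gaps S = {(P, Q) \<in> open_gaps S. P \<noteq> [] \<and> Q \<noteq> []}"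

definition rising_gaps :: "'a::linorder set \<Rightarrow> ('a list \<times> 'a list) set" where
  "rising_gaps S = {(P, Q) \<in> open_gaps S. rising_gap P Q}"

definition falling_gaps :: "'a::linorder set \<Rightarrow> ('a list \<times> 'a list) set" where
  "falling_gaps S = {(P, Q) \<in> open_gaps S. falling_gap P Q}"

lemma mem_open_gaps_iff:
  "(P, Q) \<in> open_gaps S \<longleftrightarrow>
     distinct (P @ Q) \<and> set (P @ Q) = S \<and> evil_free (P @ Q) \<and> open_gap P Q"
  by (auto simp: open_gaps_def evil_free_words_def permutations_of_set_def)

lemma finite_open_gaps [simp]:
  assumes "finite S"
  shows "finite (open_gaps S)"
proof (rule finite_subset)
  let ?D = "{xs. set xs \<subseteq> S \<and> distinct xs}"
  show "open_gaps S \<subseteq> ?D \<times> ?D"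
    by (auto simp: mem_open_gaps_iff)
  show "finite (?D \<times> ?D)"
    using finite_subset_distinct[OF assms] by blast
qed

lemma finite_interior_gaps [simp]: "finite S \<Longrightarrow> finite (interior_gaps S)"
  unfolding interior_gaps_def by (rule finite_subset[OF _ finite_open_gaps]) auto

lemma card_evil_free_words_image:
  assumes "strict_mono f"
  shows "card (evil_free_words (f ` S)) = card (evil_free_words S)"
proof -
  have inj: "inj f" using assms by (rule strict_mono_imp_inj_on)
  have "evil_free_words (f ` S) = map f ` evil_free_words S"
    using evil_free_map_iff[OF assms] inj
    by (auto simp: evil_free_words_def permutations_of_set_image_inj inj_on_subset)
  then show ?thesis
    by (simp add: card_image inj_on_subset[OF inj_mapI[OF inj]])
qed

lemma card_evil_free_words_insert_min:
  assumes "\<forall>x\<in>S. z < x"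
  shows "card (evil_free_words (insert z S)) = card (open_gaps S)"
proof -
  have z: "z \<notin> S" using assms by auto
  have iff: "P @ z # Q \<in> evil_free_words (insert z S) \<longleftrightarrow> (P, Q) \<in> open_gaps S" for P Q
  proof -
    have "P @ z # Q \<in> permutations_of_set (insert z S) \<longleftrightarrow> P @ Q \<in> permutations_of_set S"
      using z by (auto simp: permutations_of_set_def insert_ident)
    then show ?thesis
      using evil_free_insert_min_iff[of P Q z] assms
      by (auto simp: evil_free_words_def open_gaps_def permutations_of_set_def)
  qed
  have "bij_betw (\<lambda>(P, Q). P @ z # Q) (open_gaps S) (evil_free_words (insert z S))"
    unfolding bij_betw_def
  proof
    have "z \<notin> set P" "z \<notin> set Q" if "(P, Q) \<in> open_gaps S" for P Q
      using that z by (auto simp: mem_open_gaps_iff)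
    then show "inj_on (\<lambda>(P, Q). P @ z # Q) (open_gaps S)"
      by (auto intro!: inj_onI simp: append_Cons_eq_iff)
    show "(\<lambda>(P, Q). P @ z # Q) ` open_gaps S = evil_free_words (insert z S)"
    proof (intro set_eqI iffI)
      fix xs assume xs: "xs \<in> evil_free_words (insert z S)"
      then have "z \<in> set xs" by (auto simp: evil_free_words_def permutations_of_set_def)
      then obtain P Q where "xs = P @ z # Q" by (meson split_list)
      then show "xs \<in> (\<lambda>(P, Q). P @ z # Q) ` open_gaps S" using xs iff by force
    qed (use iff in auto)
  qed
  then show ?thesis by (simp add: bij_betw_same_card)
qed

lemma card_open_gaps:
  fixes S :: "'a::linorder set"
  assumes "finite S" "S \<noteq> {}"
  shows "card (open_gaps S) = 2 * card (evil_free_words S) + card (interior_gaps S)"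
proof -
  let ?first = "(\<lambda>xs. ([] :: 'a list, xs)) ` evil_free_words S"
    and ?last = "(\<lambda>xs. (xs, [] :: 'a list)) ` evil_free_words S"
  have fin: "finite (evil_free_words S)" by (simp add: evil_free_words_def)
  have nonempty: "[] \<notin> evil_free_words S"
    using assms(2) by (auto simp: evil_free_words_def permutations_of_set_def)
  have "card (?first \<union> ?last) = card ?first + card ?last"
    by (intro card_Un_disjoint) (use fin nonempty in auto)
  also have "\<dots> = 2 * card (evil_free_words S)"
    by (simp add: card_image inj_on_def)
  finally have "card (?first \<union> ?last) = 2 * card (evil_free_words S)" .
  moreover have "open_gaps S = (?first \<union> ?last) \<union> interior_gaps S"
    by (auto simp: open_gaps_def interior_gaps_def)
  moreover have "card ((?first \<union> ?last) \<union> interior_gaps S) = card (?first \<union> ?last) + card (interior_gaps S)"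
    by (intro card_Un_disjoint) (use fin finite_interior_gaps[OF assms(1)] in \<open>auto simp: interior_gaps_def\<close>)
  ultimately show ?thesis by simp
qed

lemma card_interior_gaps:
  assumes "finite S"
  shows "card (interior_gaps S) = card (rising_gaps S) + card (falling_gaps S)"
proof -
  have "interior_gaps S \<inter> rising_gaps S = rising_gaps S"
    by (auto simp: interior_gaps_def rising_gaps_def rising_gap_def)
  moreover have "interior_gaps S - rising_gaps S = falling_gaps S"
    using falling_gap_iff_not_rising_gap
    by (auto simp: interior_gaps_def rising_gaps_def falling_gaps_def mem_open_gaps_iff falling_gap_def)
  ultimately show ?thesis
    using card_Int_Diff[of "interior_gaps S" "rising_gaps S"] assms by simp
qed

lemma card_falling_gaps:
  assumes "card S \<ge> 2"
  shows "card (falling_gaps S) = card (evil_free_words S)"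
proof (rule bij_betw_same_card)
  show "bij_betw (\<lambda>(P, Q). P @ Q) (falling_gaps S) (evil_free_words S)"
    unfolding bij_betw_def
  proof
    show "inj_on (\<lambda>(P, Q). P @ Q) (falling_gaps S)"
    proof (rule inj_onI, clarify)
      fix P Q P' Q'
      assume "(P, Q) \<in> falling_gaps S" "(P', Q') \<in> falling_gaps S" and eq: "P @ Q = P' @ Q'"
      then have "P = P'"
        using falling_gap_unique[OF eq] by (simp add: falling_gaps_def)
      then show "P = P' \<and> Q = Q'" using eq by simp
    qed
    show "(\<lambda>(P, Q). P @ Q) ` falling_gaps S = evil_free_words S"
    proof (intro set_eqI iffI)
      fix xs assume xs: "xs \<in> evil_free_words S"
      then have "evil_free xs" "distinct xs" "length xs \<ge> 2"
        using assms length_finite_permutations_of_set[of xs S]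
        by (auto simp: evil_free_words_def dest: permutations_of_setD)
      then obtain P Q where "xs = P @ Q" "falling_gap P Q"
        by (rule ex_falling_gap)
      then show "xs \<in> (\<lambda>(P, Q). P @ Q) ` falling_gaps S"
        using xs by (force simp: falling_gaps_def open_gaps_def falling_gap_def)
    qed (auto simp: falling_gaps_def open_gaps_def)
  qed
qed

definition skip :: "nat \<Rightarrow> nat \<Rightarrow> nat" where
  "skip b x = (if x < b then x else Suc x)"

lemma strict_mono_skip: "strict_mono (skip b)"
  by (rule strict_monoI) (simp add: skip_def)

lemma inj_skip: "inj (skip b)"
  by (rule strict_mono_imp_inj_on) (rule strict_mono_skip)

lemma image_skip:
  assumes "b \<in> {1..Suc n}"
  shows "skip b ` {1..n} = {1..Suc n} - {b}"
proof (intro set_eqI iffI)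
  fix x assume "x \<in> {1..Suc n} - {b}"
  then have "x = skip b (if x < b then x else x - 1)" "(if x < b then x else x - 1) \<in> {1..n}"
    using assms by (auto simp: skip_def)
  then show "x \<in> skip b ` {1..n}" by blast
qed (auto simp: skip_def)

lemma Cons_map_skip_in_permutations_of_set_iff:
  assumes "b \<in> {1..Suc n}"
  shows "b # map (skip b) xs \<in> permutations_of_set {1..Suc n} \<longleftrightarrow> xs \<in> permutations_of_set {1..n}"
proof -
  have b: "b \<notin> skip b ` A" for A by (auto simp: skip_def)
  have "{1..Suc n} = insert b (skip b ` {1..n})"
    using assms by (simp only: image_skip insert_Diff)
  then have "insert b (skip b ` set xs) = {1..Suc n} \<longleftrightarrow> set xs = {1..n}"
    using b by (simp only: insert_ident inj_image_eq_iff[OF inj_skip] not_False_eq_True)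
  then show ?thesis
    using b by (simp add: permutations_of_set_def distinct_map inj_on_subset[OF inj_skip])
qed

lemma Cons_map_skip_in_open_gaps_iff:
  assumes b: "b \<in> set P" "\<And>x. x \<in> set P \<Longrightarrow> b \<le> x" "b \<in> {1..Suc n}" and dist: "distinct (P @ Q)"
  shows "(b # map (skip b) P, map (skip b) Q) \<in> open_gaps {1..Suc n} \<longleftrightarrow> (P, Q) \<in> open_gaps {1..n}"
proof -
  let ?P = "map (skip b) P" and ?Q = "map (skip b) Q"
  have "evil_free (b # ?P @ ?Q) \<and> open_gap (b # ?P) ?Q \<longleftrightarrow> evil_free (?P @ ?Q) \<and> open_gap ?P ?Q"
  proof
    assume gap: "evil_free (?P @ ?Q) \<and> open_gap ?P ?Q"
    have "b \<notin> set Q" using b(1) dist by auto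
    then have no_letter_between: "x < b \<or> Suc b < x" if "x \<in> set ?Q" for x
      using that by (auto simp: skip_def) (metis le_neq_implies_less not_less)
    moreover have min: "Suc b \<in> set ?P" "\<And>x. x \<in> set ?P \<Longrightarrow> Suc b \<le> x"
      using b(1) b(2) by (force simp: skip_def)+
    ultimately show "evil_free (b # ?P @ ?Q) \<and> open_gap (b # ?P) ?Q"
      using gap evil_free_Cons_below[OF _ _ min] open_gap_Cons_below[OF _ min] by blast
  qed (simp add: evil_free_Cons_iff open_gap_def)
  moreover have "b # ?P @ ?Q \<in> permutations_of_set {1..Suc n} \<longleftrightarrow> P @ Q \<in> permutations_of_set {1..n}"
    using Cons_map_skip_in_permutations_of_set_iff[OF b(3), of "P @ Q"] by simp
  ultimately show ?thesis
    using evil_free_map_iff[OF strict_mono_skip, of b "P @ Q"] open_gap_map_iff[OF strict_mono_skip]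
    by (auto simp: open_gaps_def evil_free_words_def)
qed

lemma Suc_in_rising_gap:
  assumes "(a # P, Q) \<in> rising_gaps {1..n}"
  shows "Suc a \<in> set P"
proof (rule ccontr)
  assume "Suc a \<notin> set P"
  have gap: "(a # P, Q) \<in> open_gaps {1..n}" and "P \<noteq> []" and above: "\<forall>x\<in>set P. a < x"
    using assms by (simp_all add: rising_gaps_def rising_gap_def)
  obtain b where b: "b \<in> set P" using \<open>P \<noteq> []\<close> by (meson hd_in_set)
  then have "a < b" "b \<noteq> Suc a" using above \<open>Suc a \<notin> set P\<close> by auto
  have letters: "set (a # P @ Q) = {1..n}"
    using gap by (simp add: mem_open_gaps_iff)
  then have "b \<le> n" using b by auto
  then have "Suc a \<in> set (a # P @ Q)" unfolding letters using \<open>a < b\<close> by simp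
  then have "Suc a \<in> set Q" using \<open>Suc a \<notin> set P\<close> by simp
  moreover have "open_gap (a # P) Q" using gap by (simp add: open_gaps_def)
  ultimately show False
    using open_gap_same_side[of "a # P" Q a b "Suc a"] b \<open>a < b\<close> \<open>b \<noteq> Suc a\<close> by auto
qed

definition prepend_below :: "nat list \<times> nat list \<Rightarrow> nat list \<times> nat list" where
  "prepend_below = (\<lambda>(P, Q). let b = Min (set P) in (b # map (skip b) P, map (skip b) Q))"

lemma inj_prepend_below: "inj prepend_below"
  by (rule injI) (auto simp: prepend_below_def Let_def inj_map_eq_map[OF inj_skip])

lemma prepend_below_interior_gaps_subset:
  "prepend_below ` interior_gaps {1..n} \<subseteq> rising_gaps {1..Suc n}"
proof (rule image_subsetI)
  fix g assume "g \<in> interior_gaps {1..n}"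
  moreover obtain P Q where g: "g = (P, Q)" by force
  ultimately have gap: "(P, Q) \<in> open_gaps {1..n}" and ne: "P \<noteq> []" "Q \<noteq> []"
    by (simp_all add: interior_gaps_def)
  define b where "b = Min (set P)"
  have b: "b \<in> set P" "\<And>x. x \<in> set P \<Longrightarrow> b \<le> x" using ne(1) by (simp_all add: b_def)
  have dist: "distinct (P @ Q)" and "set (P @ Q) = {1..n}"
    using gap by (simp_all add: mem_open_gaps_iff)
  then have "b \<in> {1..n}" using b(1) by auto
  then have "(b # map (skip b) P, map (skip b) Q) \<in> open_gaps {1..Suc n}"
    using Cons_map_skip_in_open_gaps_iff[OF b _ dist] gap by simp
  moreover have "\<forall>x\<in>set (map (skip b) P). b < x"
    using b(2) by (force simp: skip_def)
  ultimately show "prepend_below g \<in> rising_gaps {1..Suc n}"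
    using ne by (simp add: g prepend_below_def Let_def rising_gaps_def rising_gap_def open_gaps_def flip: b_def)
qed

lemma rising_gaps_subset_prepend_below:
  "rising_gaps {1..Suc n} \<subseteq> prepend_below ` interior_gaps {1..n}"
proof clarify
  fix P' Q' assume rising: "(P', Q') \<in> rising_gaps {1..Suc n}"
  then obtain a R where P': "P' = a # R" by (cases P') (auto simp: rising_gaps_def rising_gap_def)
  have gap: "(a # R, Q') \<in> open_gaps {1..Suc n}" and ne: "R \<noteq> []" "Q' \<noteq> []" and above: "\<forall>x\<in>set R. a < x"
    using rising by (simp_all add: P' rising_gaps_def rising_gap_def)
  then have dist: "distinct (a # R @ Q')" and set: "set (a # R @ Q') = {1..Suc n}"
    by (simp_all add: mem_open_gaps_iff)
  have a: "a \<in> {1..Suc n}" using set by auto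
  then have "set (R @ Q') = skip a ` {1..n}"
    using dist set unfolding image_skip[OF a] by auto
  then have "R @ Q' \<in> lists (range (skip a))" by auto
  then obtain xs where "map (skip a) xs = R @ Q'"
    unfolding lists_image by force
  then obtain P Q where PQ: "R = map (skip a) P" "Q' = map (skip a) Q"
    unfolding map_eq_append_conv by blast
  have "Suc a = skip a a" by (simp add: skip_def)
  then have "a \<in> set P"
    using Suc_in_rising_gap[OF rising[unfolded P']] inj_skip by (simp add: PQ inj_image_mem_iff)
  moreover have "a \<le> x" if "x \<in> set P" for x
  proof -
    have "a < skip a x" using above that by (simp add: PQ)
    then show ?thesis by (simp add: skip_def split: if_splits)
  qed
  moreover have "distinct (P @ Q)"
    using dist by (auto simp: PQ distinct_map)
  ultimately have "(P, Q) \<in> open_gaps {1..n}" "Min (set P) = a"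
    using Cons_map_skip_in_open_gaps_iff[OF _ _ a, of P Q] gap by (auto simp: PQ intro: Min_eqI)
  then have "(P, Q) \<in> interior_gaps {1..n}" "prepend_below (P, Q) = (P', Q')"
    using ne by (simp_all add: P' PQ prepend_below_def interior_gaps_def)
  then show "(P', Q') \<in> prepend_below ` interior_gaps {1..n}" by (metis imageI)
qed

lemma card_rising_gaps:
  "card (rising_gaps {1..Suc n}) = card (interior_gaps {1..n})"
proof -
  have "rising_gaps {1..Suc n} = prepend_below ` interior_gaps {1..n}"
    using prepend_below_interior_gaps_subset rising_gaps_subset_prepend_below
    by (intro subset_antisym)
  then show ?thesis
    by (simp add: card_image inj_on_subset[OF inj_prepend_below])
qed

lemma card_interior_gaps_rec:
  assumes "n \<ge> 1"
  shows "card (interior_gaps {1..Suc n}) = card (interior_gaps {1..n}) + card (evil_free_words {1..Suc n})"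
  using assms card_interior_gaps[of "{1..Suc n}"] card_rising_gaps[of n]
    card_falling_gaps[of "{1..Suc n}"] by simp

lemma interior_gaps_eq_empty:
  assumes "card S \<le> 1"
  shows "interior_gaps S = {}"
proof -
  have False if "(P, Q) \<in> interior_gaps S" for P Q
  proof -
    have "length (P @ Q) = card S"
      using that length_finite_permutations_of_set[of "P @ Q" S]
      by (simp add: interior_gaps_def open_gaps_def evil_free_words_def)
    then show False
      using assms that by (cases P; cases Q) (auto simp: interior_gaps_def)
  qed
  then show ?thesis by auto
qed

lemma card_evil_free_words_Suc:
  assumes "n \<ge> 1"
  shows "card (evil_free_words {1..Suc n}) = 2 * card (evil_free_words {1..n}) + card (interior_gaps {1..n})"
proof -
  have "{1..Suc n} = Suc ` insert 0 {1..n}"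
    by (simp add: image_Suc_atLeastAtMost atLeastAtMost_insertL flip: atLeast0AtMost)
  then have "card (evil_free_words {1..Suc n}) = card (evil_free_words (insert 0 {1..n}))"
    by (simp only: card_evil_free_words_image strict_monoI Suc_mono)
  also have "\<dots> = card (open_gaps {1..n})"
    by (rule card_evil_free_words_insert_min) auto
  finally show ?thesis
    using assms by (simp add: card_open_gaps)
qed

lemma card_evil_free_words_base:
  "card (evil_free_words {1..0::nat}) = 1" "card (evil_free_words {1..Suc 0}) = 1"
proof -
  have "evil_free_words {1..0::nat} = {[]}" "evil_free_words {1..Suc 0} = {[1]}"
    by (auto simp: evil_free_words_def evil_free_if_length_less)
  then show "card (evil_free_words {1..0::nat}) = 1" "card (evil_free_words {1..Suc 0}) = 1"
    by simp_all
qed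

lemma card_evil_free_words_rec:
  "card (evil_free_words {1..Suc (Suc n)}) + 2 * card (evil_free_words {1..n})
     = 4 * card (evil_free_words {1..Suc n})"
proof (cases "n = 0")
  case True
  have "interior_gaps {1..Suc 0} = {}" by (rule interior_gaps_eq_empty) simp
  then show ?thesis
    using True card_evil_free_words_Suc[of 1] card_evil_free_words_base by simp
next
  case False
  then show ?thesis
    using card_evil_free_words_Suc[of n] card_evil_free_words_Suc[of "Suc n"] card_interior_gaps_rec[of n]
    by simp
qed

section \<open>Permutations as words\<close>

definition order_isomorphic :: "'a::linorder list \<Rightarrow> 'b::linorder list \<Rightarrow> bool" where
  "order_isomorphic xs ys \<longleftrightarrow> length xs = length ys \<and>
     (\<forall>i<length ys. \<forall>j<length ys. xs ! i < xs ! j \<longleftrightarrow> ys ! i < ys ! j)"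

lemma subseq_upt_iff: "subseq xs [m..<n] \<longleftrightarrow> sorted_wrt (<) xs \<and> set xs \<subseteq> {m..<n}"
proof
  assume sub: "subseq xs [m..<n]"
  have "sorted_wrt (<) xs"
    using sub sorted_wrt_upt by (rule sorted_wrt_subseq)
  then show "sorted_wrt (<) xs \<and> set xs \<subseteq> {m..<n}"
    using subseq_imp_set_subset[OF sub] by simp
qed (simp add: sorted_subset_imp_subseq sorted_wrt_upt)

lemma contains_pattern_iff_subseq:
  "contains_pattern n p pat \<longleftrightarrow> (\<exists>ys. subseq ys (map p [1..<Suc n]) \<and> order_isomorphic ys pat)"
proof
  assume "contains_pattern n p pat"
  then obtain idx where idx: "strict_mono_on {..<length pat} idx" "idx ` {..<length pat} \<subseteq> {1..n}"
    "\<forall>i<length pat. \<forall>j<length pat. p (idx i) < p (idx j) \<longleftrightarrow> pat ! i < pat ! j"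
    unfolding contains_pattern_def by blast
  define zs where "zs = map idx [0..<length pat]"
  have "sorted_wrt (<) zs"
    using idx(1) by (simp add: zs_def sorted_wrt_iff_nth_less strict_mono_on_def)
  moreover have "set zs \<subseteq> {1..<Suc n}"
    using idx(2) by (auto simp: zs_def atLeast0LessThan)
  ultimately have "subseq (map p zs) (map p [1..<Suc n])"
    by (intro subseq_map) (simp only: subseq_upt_iff)
  moreover have "order_isomorphic (map p zs) pat"
    using idx(3) by (simp add: order_isomorphic_def zs_def)
  ultimately show "\<exists>ys. subseq ys (map p [1..<Suc n]) \<and> order_isomorphic ys pat" by blast
next
  assume "\<exists>ys. subseq ys (map p [1..<Suc n]) \<and> order_isomorphic ys pat"
  then obtain zs where zs: "subseq zs [1..<Suc n]" "order_isomorphic (map p zs) pat"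
    unfolding subseq_map_iff by blast
  then have len: "length zs = length pat" by (simp add: order_isomorphic_def)
  have "sorted_wrt (<) zs" "set zs \<subseteq> {1..<Suc n}"
    using zs(1) by (simp_all only: subseq_upt_iff)
  then have "strict_mono_on {..<length pat} ((!) zs)" "(!) zs ` {..<length pat} \<subseteq> {1..n}"
    using len by (auto intro!: strict_mono_onI simp: sorted_wrt_iff_nth_less subset_iff less_Suc_eq_le)
  moreover have "\<forall>i<length pat. \<forall>j<length pat. p (zs ! i) < p (zs ! j) \<longleftrightarrow> pat ! i < pat ! j"
    using zs(2) len by (auto simp: order_isomorphic_def)
  ultimately show "contains_pattern n p pat"
    unfolding contains_pattern_def by blast
qed

lemma evil_iff_order_isomorphic:
  "evil a b c d \<longleftrightarrow>
     order_isomorphic [a, b, c, d] [2, 4, 1, 3 :: nat] \<or> order_isomorphic [a, b, c, d] [4, 1, 3, 2 :: nat] \<or>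
     order_isomorphic [a, b, c, d] [4, 2, 1, 3 :: nat] \<or> order_isomorphic [a, b, c, d] [3, 2, 1, 4 :: nat]"
proof -
  have "order_isomorphic [a, b, c, d] [2, 4, 1, 3 :: nat] \<longleftrightarrow> c < a \<and> a < d \<and> d < b"
    "order_isomorphic [a, b, c, d] [4, 1, 3, 2 :: nat] \<longleftrightarrow> b < d \<and> d < c \<and> c < a"
    "order_isomorphic [a, b, c, d] [4, 2, 1, 3 :: nat] \<longleftrightarrow> c < b \<and> b < d \<and> d < a"
    "order_isomorphic [a, b, c, d] [3, 2, 1, 4 :: nat] \<longleftrightarrow> c < b \<and> b < a \<and> a < d"
    by (simp add: order_isomorphic_def All_less_Suc2; auto)+
  then show ?thesis by (simp add: evil_def)
qed

lemma evil_avoiding_iff_evil_free: "evil_avoiding n p \<longleftrightarrow> evil_free (map p [1..<Suc n])"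
proof -
  have "avoids n p [i, j, k, l] \<longleftrightarrow>
      (\<forall>a b c d. subseq [a, b, c, d] (map p [1..<Suc n]) \<longrightarrow> \<not> order_isomorphic [a, b, c, d] [i, j, k, l])"
    for i j k l
  proof -
    have "\<exists>a b c d. ys = [a, b, c, d]" if "order_isomorphic ys [i, j, k, l]" for ys :: "nat list"
      using that by (auto simp: order_isomorphic_def length_Suc_conv)
    then show ?thesis
      unfolding avoids_def contains_pattern_iff_subseq by blast
  qed
  then show ?thesis
    unfolding evil_avoiding_def evil_free_def evil_iff_order_isomorphic by blast
qed

lemma bij_betw_permutes_permutations_of_set:
  assumes "distinct xs"
  shows "bij_betw (\<lambda>p. map p xs) {p. p permutes set xs} (permutations_of_set (set xs))"
  unfolding bij_betw_def
proof
  show inj: "inj_on (\<lambda>p. map p xs) {p. p permutes set xs}"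
  proof (rule inj_onI, clarify)
    fix p q assume pq: "p permutes set xs" "q permutes set xs" "map p xs = map q xs"
    show "p = q"
    proof
      show "p x = q x" for x
        using pq by (cases "x \<in> set xs") (simp_all add: permutes_not_in)
    qed
  qed
  have "(\<lambda>p. map p xs) ` {p. p permutes set xs} \<subseteq> permutations_of_set (set xs)"
    using assms by (auto simp: permutations_of_set_def permutes_image permutes_inj_on distinct_map)
  then show "(\<lambda>p. map p xs) ` {p. p permutes set xs} = permutations_of_set (set xs)"
    by (intro card_subset_eq) (simp_all add: card_image[OF inj] card_permutations)
qed

lemma card_evil_avoiding_perms:
  "card {p \<in> perms n. evil_avoiding n p} = card (evil_free_words {1..n})"
proof (rule bij_betw_same_card)
  have "set [1..<Suc n] = {1..n}" by auto
  then have "bij_betw (\<lambda>p. map p [1..<Suc n]) (perms n) (permutations_of_set {1..n})"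
    using bij_betw_permutes_permutations_of_set[of "[1..<Suc n]"] by (simp only: perms_def distinct_upt)
  then show "bij_betw (\<lambda>p. map p [1..<Suc n]) {p \<in> perms n. evil_avoiding n p} (evil_free_words {1..n})"
    unfolding evil_free_words_def by (rule bij_betw_Collect) (rule evil_avoiding_iff_evil_free[symmetric])
qed

lemma card_evil_free_words_eq_card_almost_increasing_perms:
  "card (evil_free_words {1..n}) = card (almost_increasing_perms n)"
proof (induction n rule: induct_nat_012)
  case 0
  show ?case by (simp only: card_evil_free_words_base card_almost_increasing_perms_base)
next
  case 1
  show ?case by (simp only: card_evil_free_words_base card_almost_increasing_perms_base)
next
  case (ge2 n)
  then show ?case
    using card_evil_free_words_rec[of n] card_almost_increasing_perms_rec[of n] by simp
qed

theorem theorem7p3: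
  fixes n :: nat
  assumes "n \<ge> 1"
  shows "card {p \<in> perms n. one_almost_increasing n p} = card {p \<in> perms n. evil_avoiding n p}"
proof -
  have "card {p \<in> perms n. one_almost_increasing n p} = card (evil_free_words {1..n})"
    by (simp only: card_evil_free_words_eq_card_almost_increasing_perms almost_increasing_perms_def)
  then show ?thesis
    by (simp only: card_evil_avoiding_perms)
qed

end
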